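(* Let $2 \leq t+1 < r_1 \leq \dots \leq r_k$ (with $k\geq 2$), and for each $i \in [k]$ let $\mathcal{F}_i = \mathsf{P}_{n_i,r_i}$ with $n_i \geq (r_i-t-1)\,c(r_{k-1},r_k,t) + t + 1$. Then $(\mathcal{F}_1, \dots, \mathcal{F}_k)$ has the extrastrong cross-$t$-star property.
   Context: A partition of a set $X$ of length $r$ is a set $\{X_1,\dots,X_r\}$ of pairwise disjoint non-empty sets (parts) whose union is $X$; $\mathsf{P}_{n,r}$ is the family of all partitions of $[n]$ of length $r$, each partition viewed as a set whose elements are its parts. $c(r,s,t)=\max\{r\binom{s}{t},s\binom{r}{t}\}+1$ if $t\leq\min\{r,s\}$, and $1$ otherwise. $\mathcal{F}(T)=\{F\in\mathcal{F}:T\subseteq F\}$. Families $\mathcal{A}_1,\dots,\mathcal{A}_k$ are cross-$t$-intersecting if for all distinct $i,j$ each member of $\mathcal{A}_i$ shares at least $t$ elements (here: parts) with each member of $\mathcal{A}_j$; the tuple is below $(\mathcal{F}_1,\dots,\mathcal{F}_k)$ if $\mathcal{A}_i\subseteq\mathcal{F}_i$. Extrastrong cross-$t$-star property: there is a $t$-element set $T$ such that for every cross-$t$-intersecting tuple below $(\mathcal{F}_1,\dots,\mathcal{F}_k)$, $\prod|\mathcal{A}_i|\leq\prod|\mathcal{F}_i(T)|$, with equality only if there is a $t$-set $T'$ with $\mathcal{A}_i=\mathcal{F}_i(T')$ for all $i$. *)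

theory Defs
  imports Complex_Main "HOL-Library.Disjoint_Sets"
begin

text \<open>A tuple of \<open>k\<close> families is a function on \<^typ>\<open>nat\<close>, of which only the values at
  the indices \<open>1, \<dots>, k\<close> matter.\<close>

definition partitions_of_length :: "nat \<Rightarrow> nat \<Rightarrow> nat set set set" where
  "partitions_of_length n r = {P. partition_on {1..n} P \<and> card P = r}"

definition c_const :: "nat \<Rightarrow> nat \<Rightarrow> nat \<Rightarrow> nat" where
  "c_const r s t =
     (if t \<le> min r s then max (r * (s choose t)) (s * (r choose t)) + 1 else 1)"

definition star :: "'a set set \<Rightarrow> 'a set \<Rightarrow> 'a set set" where
  "star F T = {A \<in> F. T \<subseteq> A}"

text \<open>Families and their members are understood to be finite, so that \<^const>\<open>card\<close>
  is the actual size.\<close>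

definition cross_t_intersecting :: "nat \<Rightarrow> nat \<Rightarrow> (nat \<Rightarrow> 'a set set) \<Rightarrow> bool" where
  "cross_t_intersecting t k \<A> \<longleftrightarrow>
     (\<forall>i\<in>{1..k}. \<forall>j\<in>{1..k}. i \<noteq> j \<longrightarrow> (\<forall>A\<in>\<A> i. \<forall>B\<in>\<A> j. t \<le> card (A \<inter> B)))"

definition below :: "nat \<Rightarrow> (nat \<Rightarrow> 'a set set) \<Rightarrow> (nat \<Rightarrow> 'a set set) \<Rightarrow> bool" where
  "below k \<A> \<F> \<longleftrightarrow> (\<forall>i\<in>{1..k}. \<A> i \<subseteq> \<F> i)"

definition extrastrong_cross_t_star_property :: "nat \<Rightarrow> nat \<Rightarrow> (nat \<Rightarrow> 'a set set) \<Rightarrow> bool" where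
  "extrastrong_cross_t_star_property t k \<F> \<longleftrightarrow>
     (\<exists>T. finite T \<and> card T = t \<and>
       (\<forall>\<A>. below k \<A> \<F> \<longrightarrow> cross_t_intersecting t k \<A> \<longrightarrow>
          (\<Prod>i\<in>{1..k}. card (\<A> i)) \<le> (\<Prod>i\<in>{1..k}. card (star (\<F> i) T)) \<and>
          ((\<Prod>i\<in>{1..k}. card (\<A> i)) = (\<Prod>i\<in>{1..k}. card (star (\<F> i) T)) \<longrightarrow>
             (\<exists>T'. finite T' \<and> card T' = t \<and> (\<forall>i\<in>{1..k}. \<A> i = star (\<F> i) T')))))"

end

theory Submission
  imports Defs "HOL-Combinatorics.Stirling"
begin

text \<open>In \<open>\<F>\<^sub>i\<close>, the stars of \<open>(t + 1)\<close>-sets are smaller than the largest star of a \<open>t\<close>-set by a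
  factor that beats \<open>r\<^sub>j\<close> times \<open>r\<^sub>i choose t\<close>, because the Stirling numbers
  \<open>S(n\<^sub>i - t, r\<^sub>i - t)\<close> and \<open>S(n\<^sub>i - t - 1, r\<^sub>i - t - 1)\<close> are far apart. This gap settles every pair
  of families, and forces a pair attaining the bound to be the pair of stars of a common \<open>t\<close>-set,
  which is determined by either star. Multiplying the bounds for the cyclically
  consecutive pairs gives the square of the bound for the whole tuple, and in the case of equality
  consecutive pairs overlap, so that all \<open>t\<close>-sets agree.\<close>

section \<open>Cross-intersecting pairs\<close>

lemma star_subset: "star F T \<subseteq> F"
  by (auto simp: star_def)

text \<open>A member meeting \<open>B\<close> in at least \<open>t\<close> elements cannot meet it inside \<open>T\<close>, hence contains
  \<open>T\<close> and a further element of \<open>B\<close>.\<close>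

lemma card_star_le_if_not_subset:
  assumes "finite F" "\<A> \<subseteq> F" "finite B" "finite T" "card T = t" "\<not> T \<subseteq> B"
    and cross: "\<And>A. A \<in> \<A> \<Longrightarrow> t \<le> card (A \<inter> B)"
    and bound: "\<And>T. finite T \<Longrightarrow> card T = Suc t \<Longrightarrow> card (star F T) \<le> m"
  shows "card (star \<A> T) \<le> card B * m"
proof -
  have "star \<A> T \<subseteq> (\<Union>x\<in>B - T. star F (insert x T))"
  proof
    fix A assume A: "A \<in> star \<A> T"
    have "\<not> A \<inter> B \<subseteq> T"
    proof
      assume "A \<inter> B \<subseteq> T"
      with A cross[of A] assms(4,5) have "A \<inter> B = T"
        by (metis (no_types, lifting) card_seteq mem_Collect_eq star_def)
      with assms(6) show False by blast
    qed
    then obtain x where "x \<in> A" "x \<in> B" "x \<notin> T" by blast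
    with A assms(2) show "A \<in> (\<Union>x\<in>B - T. star F (insert x T))"
      by (auto simp: star_def)
  qed
  moreover have "finite (\<Union>x\<in>B - T. star F (insert x T))"
    using assms(1) by (rule rev_finite_subset) (auto simp: star_def)
  ultimately have "card (star \<A> T) \<le> card (\<Union>x\<in>B - T. star F (insert x T))"
    by (intro card_mono)
  also have "\<dots> \<le> (\<Sum>x\<in>B - T. card (star F (insert x T)))"
    using assms(3) by (intro card_UN_le) auto
  also have "\<dots> \<le> (\<Sum>x\<in>B - T. m)"
    using assms(4,5) by (intro sum_mono bound) auto
  also have "\<dots> \<le> card B * m"
    using assms(3) by (simp add: card_mono)
  finally show ?thesis .
qed

text \<open>Every member contains some \<open>t\<close>-subset of \<open>B\<close>, so the stars of
  these subsets cover the whole family.\<close>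

lemma card_le_choose_mult:
  assumes "finite \<A>" "finite B"
    and cross: "\<And>A. A \<in> \<A> \<Longrightarrow> t \<le> card (A \<inter> B)"
    and bound: "\<And>T. finite T \<Longrightarrow> card T = t \<Longrightarrow> card (star \<A> T) \<le> m"
  shows "card \<A> \<le> (card B choose t) * m"
proof -
  let ?\<T> = "{T. T \<subseteq> B \<and> card T = t}"
  have fin: "finite ?\<T>" using assms(2) by simp
  have "\<A> \<subseteq> (\<Union>T\<in>?\<T>. star \<A> T)"
  proof
    fix A assume A: "A \<in> \<A>"
    obtain T where "T \<subseteq> A \<inter> B" "card T = t"
      using obtain_subset_with_card_n[OF cross[OF A]] by blast
    with A show "A \<in> (\<Union>T\<in>?\<T>. star \<A> T)"
      by (auto simp: star_def)
  qed
  moreover have "finite (\<Union>T\<in>?\<T>. star \<A> T)"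
    using assms(1) by (rule rev_finite_subset) (auto simp: star_def)
  ultimately have "card \<A> \<le> card (\<Union>T\<in>?\<T>. star \<A> T)"
    by (intro card_mono)
  also have "\<dots> \<le> (\<Sum>T\<in>?\<T>. card (star \<A> T))"
    by (intro card_UN_le fin)
  also have "\<dots> \<le> (\<Sum>T\<in>?\<T>. m)"
    using assms(2) by (intro sum_mono bound) (auto intro: finite_subset)
  also have "\<dots> = (card B choose t) * m"
    by (simp add: n_subsets[OF assms(2)])
  finally show ?thesis .
qed

text \<open>If some \<open>t\<close>-set lies in all members of both families, the second disjunct holds. If a \<open>t\<close>-set
  lies in all members of just one family, that family is bounded by the stars of \<open>(t + 1)\<close>-sets
  and the other one by the stars of \<open>t\<close>-sets; otherwise both are bounded by the stars of
  \<open>(t + 1)\<close>-sets.\<close>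

lemma cross_intersecting_pair:
  assumes F: "finite F" "\<And>A. A \<in> F \<Longrightarrow> finite A \<and> card A = r"
    and G: "finite G" "\<And>B. B \<in> G \<Longrightarrow> finite B \<and> card B = s"
    and a: "\<And>T. finite T \<Longrightarrow> card T = t \<Longrightarrow> card (star F T) \<le> a"
    and b: "\<And>T. finite T \<Longrightarrow> card T = t \<Longrightarrow> card (star G T) \<le> b"
    and a': "\<And>T. finite T \<Longrightarrow> card T = Suc t \<Longrightarrow> card (star F T) \<le> a'"
    and b': "\<And>T. finite T \<Longrightarrow> card T = Suc t \<Longrightarrow> card (star G T) \<le> b'"
    and ratio: "s * (r choose t) * a' < a" "r * (s choose t) * b' < b"
    and sub: "\<A> \<subseteq> F" "\<B> \<subseteq> G"
    and cross: "\<And>A B. A \<in> \<A> \<Longrightarrow> B \<in> \<B> \<Longrightarrow> t \<le> card (A \<inter> B)"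
  shows "card \<A> * card \<B> < a * b \<or>
    (\<exists>T. finite T \<and> card T = t \<and> \<A> \<subseteq> star F T \<and> \<B> \<subseteq> star G T)"
proof (cases "\<A> = {} \<or> \<B> = {}")
  case True
  with ratio show ?thesis by auto
next
  case False
  \<comment> \<open>These two members are fixed as the sets whose \<open>t\<close>-subsets index a
    cover of the opposite family.\<close>
  then obtain A0 B0 where A0: "A0 \<in> \<A>" and B0: "B0 \<in> \<B>" by blast
  have cross': "t \<le> card (B \<inter> A)" if "A \<in> \<A>" "B \<in> \<B>" for A B
    using cross[OF that] by (simp add: Int_commute)
  have fin: "finite \<A>" "finite \<B>"
    using sub F(1) G(1) finite_subset by auto
  have A0': "finite A0" "card A0 = r" and B0': "finite B0" "card B0 = s"
    using A0 B0 sub F(2) G(2) by auto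
  have starA: "card (star \<A> T) \<le> s * a'"
    if "finite T" "card T = t" "B \<in> \<B>" "\<not> T \<subseteq> B" for T B
  proof -
    have B: "finite B" "card B = s" using that(3) sub(2) G(2) by auto
    show ?thesis unfolding B(2)[symmetric]
      by (rule card_star_le_if_not_subset[OF F(1) sub(1) B(1) that(1,2,4)])
        (use that(3) cross a' in blast)+
  qed
  have starB: "card (star \<B> T) \<le> r * b'"
    if "finite T" "card T = t" "A \<in> \<A>" "\<not> T \<subseteq> A" for T A
  proof -
    have A: "finite A" "card A = r" using that(3) sub(1) F(2) by auto
    show ?thesis unfolding A(2)[symmetric]
      by (rule card_star_le_if_not_subset[OF G(1) sub(2) A(1) that(1,2,4)])
        (use that(3) cross' b' in blast)+
  qed
  have leA: "card \<A> \<le> (s choose t) * m"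
    if "\<And>T. finite T \<Longrightarrow> card T = t \<Longrightarrow> card (star \<A> T) \<le> m" for m
    unfolding B0'(2)[symmetric] using that
    by (intro card_le_choose_mult[OF fin(1) B0'(1)]) (use cross B0 in blast)+
  have leB: "card \<B> \<le> (r choose t) * m"
    if "\<And>T. finite T \<Longrightarrow> card T = t \<Longrightarrow> card (star \<B> T) \<le> m" for m
    unfolding A0'(2)[symmetric] using that
    by (intro card_le_choose_mult[OF fin(2) A0'(1)]) (use cross' A0 in blast)+
  have mono: "card (star \<A> T) \<le> card (star F T)" "card (star \<B> T) \<le> card (star G T)" for T
    using sub finite_subset[OF star_subset F(1)] finite_subset[OF star_subset G(1)]
    by (auto intro!: card_mono simp: star_def)
  have all: "card \<A> = card (star \<A> T)" if "\<forall>A\<in>\<A>. T \<subseteq> A" for T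
    using that by (intro arg_cong[where f = card]) (auto simp: star_def)
  have all': "card \<B> = card (star \<B> T)" if "\<forall>B\<in>\<B>. T \<subseteq> B" for T
    using that by (intro arg_cong[where f = card]) (auto simp: star_def)
  consider T where "finite T" "card T = t" "\<forall>A\<in>\<A>. T \<subseteq> A" "\<forall>B\<in>\<B>. T \<subseteq> B"
    | T B where "finite T" "card T = t" "\<forall>A\<in>\<A>. T \<subseteq> A" "B \<in> \<B>" "\<not> T \<subseteq> B"
    | T A where "finite T" "card T = t" "\<forall>B\<in>\<B>. T \<subseteq> B" "A \<in> \<A>" "\<not> T \<subseteq> A"
    | "\<And>T. finite T \<Longrightarrow> card T = t \<Longrightarrow> (\<exists>A\<in>\<A>. \<not> T \<subseteq> A) \<and> (\<exists>B\<in>\<B>. \<not> T \<subseteq> B)"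
    by metis
  then show ?thesis
  proof cases
    case 1
    then show ?thesis using sub by (auto simp: star_def intro!: exI[of _ T])
  next
    case 2
    have "card \<A> * card \<B> \<le> (s * a') * ((r choose t) * b)"
      using starA[OF 2(1,2,4,5)] all[OF 2(3)] leB[of b] mono(2) b
      by (intro mult_le_mono) (auto intro: order_trans)
    also have "\<dots> = (s * (r choose t) * a') * b" by simp
    also have "\<dots> < a * b" using ratio by simp
    finally show ?thesis ..
  next
    case 3
    have "card \<A> * card \<B> \<le> ((s choose t) * a) * (r * b')"
      using starB[OF 3(1,2,4,5)] all'[OF 3(3)] leA[of a] mono(1) a
      by (intro mult_le_mono) (auto intro: order_trans)
    also have "\<dots> = a * (r * (s choose t) * b')" by simp
    also have "\<dots> < a * b" using ratio by simp
    finally show ?thesis ..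
  next
    case 4
    have "card \<A> \<le> (s choose t) * (s * a')"
      using starA 4 by (intro leA) blast
    moreover have "card \<B> \<le> (r choose t) * (r * b')"
      using starB 4 by (intro leB) blast
    ultimately have "card \<A> * card \<B> \<le> ((s choose t) * (s * a')) * ((r choose t) * (r * b'))"
      by (rule mult_le_mono)
    \<comment> \<open>The two bounds exchange their binomial coefficients, which produces exactly
      the left-hand sides of \<open>ratio\<close>.\<close>
    also have "\<dots> = (s * (r choose t) * a') * (r * (s choose t) * b')" by simp
    also have "\<dots> < a * b" using ratio by (intro mult_strict_mono) auto
    finally show ?thesis ..
  qed
qed

text \<open>If two different \<open>t\<close>-sets had the same star, its members would contain
  \<open>T\<close> and also an element of \<open>T'\<close> outside \<open>T\<close>. The star would
  then lie in the star of a \<open>(t + 1)\<close>-set, for which it is too large.\<close>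

lemma star_eq_star_imp_eq:
  assumes "finite F" "finite T" "card T = t" "finite T'" "card T' = t"
    and bound: "\<And>T. finite T \<Longrightarrow> card T = Suc t \<Longrightarrow> card (star F T) \<le> m"
    and "m < card (star F T)" "star F T = star F T'"
  shows "T = T'"
proof (rule ccontr)
  assume "T \<noteq> T'"
  then obtain x where x: "x \<in> T'" "x \<notin> T"
    using assms(2-5) by (metis card_subset_eq subsetI)
  have "star F T \<subseteq> star F (insert x T)"
    using assms(8) x by (auto simp: star_def)
  then have "card (star F T) \<le> card (star F (insert x T))"
    using assms(1) finite_subset[OF star_subset] by (intro card_mono) auto
  also have "\<dots> \<le> m"
    using assms(2,3) x by (intro bound) auto
  finally show False using assms(7) by simp
qed

section \<open>Families of any length\<close>

text \<open>Over \<open>i\<close> in \<open>{1..k}\<close>, the pairs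
  \<open>(i, cyc_succ k i)\<close> use every index once in each position. For \<open>k = 2\<close>
  they are \<open>(1, 2)\<close> and \<open>(2, 1)\<close>, so two families need no separate
  treatment.\<close>

definition cyc_succ :: "nat \<Rightarrow> nat \<Rightarrow> nat" where
  "cyc_succ k i = (if i = k then 1 else Suc i)"

lemma bij_betw_cyc_succ: "1 \<le> k \<Longrightarrow> bij_betw (cyc_succ k) {1..k} {1..k}"
  by (rule bij_betw_byWitness[where f' = "\<lambda>i. if i = 1 then k else i - 1"])
    (auto simp: cyc_succ_def)

text \<open>Reindexing along the cycle turns the product of the pair products into the square of the
  full product. Equality passes back to every pair, because a single strict pair among positive
  bounds would make the whole product strict.\<close>

lemma prod_le_if_cyclic_pairs_le:
  fixes x y :: "nat \<Rightarrow> nat"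
  assumes k: "1 \<le> k"
    and le: "\<And>i. i \<in> {1..k} \<Longrightarrow> x i * x (cyc_succ k i) \<le> y i * y (cyc_succ k i)"
    and pos: "\<And>i. i \<in> {1..k} \<Longrightarrow> 0 < y i"
  shows "(\<Prod>i\<in>{1..k}. x i) \<le> (\<Prod>i\<in>{1..k}. y i)"
    and "(\<Prod>i\<in>{1..k}. x i) = (\<Prod>i\<in>{1..k}. y i) \<Longrightarrow> i \<in> {1..k} \<Longrightarrow>
      x i * x (cyc_succ k i) = y i * y (cyc_succ k i)"
proof -
  have sq: "(\<Prod>i\<in>{1..k}. z i * z (cyc_succ k i)) = (\<Prod>i\<in>{1..k}. z i)\<^sup>2" for z :: "nat \<Rightarrow> nat"
    using prod.reindex_bij_betw[OF bij_betw_cyc_succ[OF k], of z]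
    by (simp add: prod.distrib power2_eq_square)
  have "(\<Prod>i\<in>{1..k}. x i)\<^sup>2 \<le> (\<Prod>i\<in>{1..k}. y i)\<^sup>2"
    unfolding sq[symmetric] by (intro prod_mono) (use le in auto)
  then show "(\<Prod>i\<in>{1..k}. x i) \<le> (\<Prod>i\<in>{1..k}. y i)"
    by (simp add: power2_nat_le_eq_le)
  assume eq: "(\<Prod>i\<in>{1..k}. x i) = (\<Prod>i\<in>{1..k}. y i)" and i: "i \<in> {1..k}"
  show "x i * x (cyc_succ k i) = y i * y (cyc_succ k i)"
  proof (rule ccontr)
    assume "x i * x (cyc_succ k i) \<noteq> y i * y (cyc_succ k i)"
    with le[OF i] have "x i * x (cyc_succ k i) < y i * y (cyc_succ k i)" by simp
    then have "(\<Prod>i\<in>{1..k}. x i * x (cyc_succ k i)) < (\<Prod>i\<in>{1..k}. y i * y (cyc_succ k i))"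
      using i le pos bij_betwE[OF bij_betw_cyc_succ[OF k]]
      by (intro prod_mono_strict) auto
    with eq show False unfolding sq by simp
  qed
qed

text \<open>Collects what is asked of the families: members of constant size, one set
  \<open>T0\<close> whose star is largest among those of \<open>t\<close>-sets in all families at
  once, and stars of \<open>(t + 1)\<close>-sets that are too small to compete.\<close>

theorem extrastrong_if_star_ratios:
  assumes k: "2 \<le> k"
    and F: "\<And>i. i \<in> {1..k} \<Longrightarrow> finite (\<F> i)"
      "\<And>i A. i \<in> {1..k} \<Longrightarrow> A \<in> \<F> i \<Longrightarrow> finite A \<and> card A = r i"
    and T0: "finite T0" "card T0 = t"
    and large: "\<And>i T. i \<in> {1..k} \<Longrightarrow> finite T \<Longrightarrow> card T = t \<Longrightarrow>
      card (star (\<F> i) T) \<le> card (star (\<F> i) T0)"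
    and small: "\<And>i T. i \<in> {1..k} \<Longrightarrow> finite T \<Longrightarrow> card T = Suc t \<Longrightarrow> card (star (\<F> i) T) \<le> m i"
    and ratio: "\<And>i j. i \<in> {1..k} \<Longrightarrow> j \<in> {1..k} \<Longrightarrow> i \<noteq> j \<Longrightarrow>
      r j * (r i choose t) * m i < card (star (\<F> i) T0)"
    and small_less: "\<And>i. i \<in> {1..k} \<Longrightarrow> m i < card (star (\<F> i) T0)"
  shows "extrastrong_cross_t_star_property t k \<F>"
  unfolding extrastrong_cross_t_star_property_def
proof (rule exI[of _ T0], intro conjI allI impI T0)
  fix \<A> assume below: "below k \<A> \<F>" and cross: "cross_t_intersecting t k \<A>"
  let ?y = "\<lambda>i. card (star (\<F> i) T0)"
  have pair: "card (\<A> i) * card (\<A> j) < ?y i * ?y j \<or>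
    (\<exists>T. finite T \<and> card T = t \<and> \<A> i \<subseteq> star (\<F> i) T \<and> \<A> j \<subseteq> star (\<F> j) T)"
    if "i \<in> {1..k}" "j \<in> {1..k}" "i \<noteq> j" for i j
  proof (rule cross_intersecting_pair)
    show "t \<le> card (A \<inter> B)" if "A \<in> \<A> i" "B \<in> \<A> j" for A B
      using cross that \<open>i \<in> {1..k}\<close> \<open>j \<in> {1..k}\<close> \<open>i \<noteq> j\<close>
      unfolding cross_t_intersecting_def by blast
    show "card (star (\<F> i) T) \<le> m i" "card (star (\<F> j) T) \<le> m j"
      if "finite T" "card T = Suc t" for T
      using small that \<open>i \<in> {1..k}\<close> \<open>j \<in> {1..k}\<close> by auto
  qed (use that F large ratio below in \<open>auto simp: below_def\<close>)
  have fin_star: "finite (star (\<F> i) T)" if "i \<in> {1..k}" for i T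
    using F(1)[OF that] star_subset finite_subset by metis
  have cardA: "card (\<A> i) \<le> ?y i"
    if "i \<in> {1..k}" "finite T" "card T = t" "\<A> i \<subseteq> star (\<F> i) T" for i T
    using card_mono[OF fin_star that(4)] large[OF that(1-3)] that(1) by simp
  have pair_le: "card (\<A> i) * card (\<A> j) \<le> ?y i * ?y j"
    if "i \<in> {1..k}" "j \<in> {1..k}" "i \<noteq> j" for i j
    using pair[OF that]
  proof (elim disjE exE conjE)
    fix T assume T: "finite T" "card T = t" "\<A> i \<subseteq> star (\<F> i) T" "\<A> j \<subseteq> star (\<F> j) T"
    show ?thesis
      using cardA[OF that(1) T(1-3)] cardA[OF that(2) T(1,2,4)] by (rule mult_le_mono)
  qed simp
  have succ: "cyc_succ k i \<in> {1..k}" "i \<noteq> cyc_succ k i" if "i \<in> {1..k}" for i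
    using that k by (auto simp: cyc_succ_def)
  have pos: "0 < ?y i" if "i \<in> {1..k}" for i
    using small_less[OF that] by simp
  note cyclic = prod_le_if_cyclic_pairs_le[of k "\<lambda>i. card (\<A> i)" ?y]
  show "(\<Prod>i\<in>{1..k}. card (\<A> i)) \<le> (\<Prod>i\<in>{1..k}. ?y i)"
    using k pair_le succ pos by (intro cyclic(1)) auto
  assume eq: "(\<Prod>i\<in>{1..k}. card (\<A> i)) = (\<Prod>i\<in>{1..k}. ?y i)"
  \<comment> \<open>At first \<open>T\<close> may vary with \<open>i\<close>. The clause on
    \<open>?y i\<close> records that the star of \<open>T\<close> is as large as that of
    \<open>T0\<close>, so that this star determines \<open>T\<close>.\<close>
  have "\<exists>T. finite T \<and> card T = t \<and> \<A> i = star (\<F> i) T \<and> ?y i = card (star (\<F> i) T) \<and>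
      \<A> (cyc_succ k i) = star (\<F> (cyc_succ k i)) T" if i: "i \<in> {1..k}" for i
  proof -
    let ?j = "cyc_succ k i"
    note j = succ[OF i]
    have prod_eq: "card (\<A> i) * card (\<A> ?j) = ?y i * ?y ?j"
      using k pair_le succ pos eq i by (intro cyclic(2)) auto
    then obtain T where T: "finite T" "card T = t" "\<A> i \<subseteq> star (\<F> i) T" "\<A> ?j \<subseteq> star (\<F> ?j) T"
      using pair[OF i j] by auto
    have le: "card (\<A> i) \<le> ?y i" "card (\<A> ?j) \<le> ?y ?j"
      using cardA T i j by auto
    \<comment> \<open>Neither factor exceeds its positive bound, so equal products force equal
      factors.\<close>
    have eqi: "card (\<A> i) = ?y i"
    proof (rule ccontr)
      assume ne: "card (\<A> i) \<noteq> ?y i"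
      have "card (\<A> i) * card (\<A> ?j) \<le> card (\<A> i) * ?y ?j"
        using le by simp
      also have "\<dots> < ?y i * ?y ?j"
        using ne le pos[OF j(1)] by simp
      finally show False using prod_eq by simp
    qed
    with prod_eq pos[OF i] have eqj: "card (\<A> ?j) = ?y ?j" by simp
    have "\<A> i = star (\<F> i) T"
      using eqi large[OF i T(1,2)] by (intro card_seteq fin_star[OF i] T(3)) simp
    moreover have "\<A> ?j = star (\<F> ?j) T"
      using eqj large[OF j(1) T(1,2)] by (intro card_seteq fin_star[OF j(1)] T(4)) simp
    ultimately show ?thesis using T eqi by auto
  qed
  then obtain \<tau> where \<tau>: "\<And>i. i \<in> {1..k} \<Longrightarrow> finite (\<tau> i) \<and> card (\<tau> i) = t \<and>
      \<A> i = star (\<F> i) (\<tau> i) \<and> ?y i = card (star (\<F> i) (\<tau> i)) \<and>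
      \<A> (cyc_succ k i) = star (\<F> (cyc_succ k i)) (\<tau> i)"
    by metis
  \<comment> \<open>The family at \<open>Suc i\<close> is the star of \<open>\<tau> i\<close>, as
    second entry of one pair, and of \<open>\<tau> (Suc i)\<close>, as first entry of the
    next.\<close>
  have step: "\<tau> i = \<tau> (Suc i)" if "1 \<le> i" "i < k" for i
  proof -
    have i: "i \<in> {1..k}" "Suc i \<in> {1..k}" "cyc_succ k i = Suc i"
      using that by (auto simp: cyc_succ_def)
    have "\<tau> (Suc i) = \<tau> i"
      using \<tau>[OF i(1)] \<tau>[OF i(2)] i small_less[OF i(2)]
      by (intro star_eq_star_imp_eq[OF F(1)[OF i(2)] _ _ _ _ small[OF i(2)]]) auto
    then show ?thesis ..
  qed
  have const: "i \<le> k \<Longrightarrow> \<tau> i = \<tau> 1" if "1 \<le> i" for i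
    using that by (induction i rule: dec_induct) (use step in auto)
  show "\<exists>T'. finite T' \<and> card T' = t \<and> (\<forall>i\<in>{1..k}. \<A> i = star (\<F> i) T')"
  proof (intro exI[of _ "\<tau> 1"] conjI ballI)
    show "finite (\<tau> 1)" "card (\<tau> 1) = t"
      using \<tau>[of 1] k by auto
    show "\<A> i = star (\<F> i) (\<tau> 1)" if "i \<in> {1..k}" for i
      using \<tau>[OF that] const[of i] that by simp
  qed
qed

section \<open>Set partitions\<close>

text \<open>The ground set is arbitrary because the counting inducts on it, and because fixing the
  parts in \<open>T\<close> removes their points from it.\<close>

definition partitions_into :: "'a set \<Rightarrow> nat \<Rightarrow> 'a set set set" where
  "partitions_into A r = {P. partition_on A P \<and> card P = r}"

lemma finite_partitions_into: "finite A \<Longrightarrow> finite (partitions_into A r)"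
  unfolding partitions_into_def
  by (rule finite_subset[OF _ finitely_many_partition_on]) auto

section \<open>The Stirling recurrence, by the part that contains a new point\<close>

lemma partitions_into_containing_singleton:
  assumes "finite A" "x \<notin> A"
  shows "{P \<in> partitions_into (insert x A) (Suc r). {x} \<in> P} = insert {x} ` partitions_into A r"
    (is "?L = ?R")
proof
  show "?L \<subseteq> ?R"
  proof
    fix P assume "P \<in> ?L"
    then have P: "partition_on (insert x A) P" "card P = Suc r" "{x} \<in> P"
      by (auto simp: partitions_into_def)
    have "{x} \<inter> Y = {}" if "Y \<in> P - {{x}}" for Y
      using P(1,3) that by (intro disjointD[OF partition_onD2]) auto
    then have "disjnt {x} (\<Union>(P - {{x}}))" by (auto simp: disjnt_def)
    from partition_on_insert[OF this, of "insert x A"] have "partition_on A (P - {{x}})"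
      using P assms(2) by (simp add: insert_absorb)
    with P show "P \<in> ?R"
      by (intro image_eqI[of _ _ "P - {{x}}"]) (auto simp: partitions_into_def)
  qed
  show "?R \<subseteq> ?L"
  proof
    fix P assume "P \<in> ?R"
    then obtain Q where Q: "P = insert {x} Q" "partition_on A Q" "card Q = r"
      by (auto simp: partitions_into_def)
    have U: "\<Union>Q = A" using Q(2) by (simp add: partition_on_def)
    have "partition_on (insert x A) P"
      unfolding Q(1) using Q(2) U assms(2) by (subst partition_on_insert) (auto simp: disjnt_def)
    moreover have "{x} \<notin> Q" using U assms(2) by blast
    ultimately show "P \<in> ?L"
      using Q finite_elements[OF assms(1) Q(2)] by (auto simp: partitions_into_def)
  qed
qed

text \<open>If \<open>x\<close> shares its part, deleting \<open>x\<close> leaves a partition of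
  \<open>A\<close> with equally many parts. The part that lost \<open>x\<close> has to be
  remembered, hence the pairs of a partition \<open>Q\<close> and a part \<open>X\<close> of
  it.\<close>

lemma partitions_into_extending_part:
  assumes "finite A" "x \<notin> A"
  shows "{P \<in> partitions_into (insert x A) r. {x} \<notin> P} =
    (\<lambda>(Q, X). insert (insert x X) (Q - {X})) ` (SIGMA Q:partitions_into A r. Q)"
    (is "?L = ?f ` ?S")
proof
  show "?L \<subseteq> ?f ` ?S"
  proof
    fix P assume "P \<in> ?L"
    then have P: "partition_on (insert x A) P" "card P = r" "{x} \<notin> P"
      by (auto simp: partitions_into_def)
    have U: "\<Union>P = insert x A" using P(1) by (simp add: partition_on_def)
    then obtain Y where Y: "Y \<in> P" "x \<in> Y" by blast
    have dis: "Z \<inter> Y = {}" if "Z \<in> P" "Z \<noteq> Y" for Z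
      using P(1) that Y(1) by (auto simp: partition_on_def disjoint_def)
    define X where "X = Y - {x}"
    have X: "insert x X = Y" "x \<notin> X"
      using Y by (auto simp: X_def)
    then have "X \<noteq> {}" using Y P(3) by auto
    \<comment> \<open>As a non-empty proper subset of \<open>Y\<close>, the set \<open>X\<close> is
      not disjoint from \<open>Y\<close> and cannot be another part. Hence replacing
      \<open>Y\<close> by \<open>X\<close> keeps the number of parts.\<close>
    have "X \<notin> P" using dis[of X] X \<open>X \<noteq> {}\<close> by auto
    have "disjnt Y (\<Union>(P - {Y}))" using dis by (auto simp: disjnt_def)
    from partition_on_insert[OF this, of "insert x A"]
    have PY: "partition_on (insert x A - Y) (P - {Y})" "Y \<subseteq> insert x A"
      using P(1) Y(1) by (auto simp: insert_absorb)
    have eq: "A - X = insert x A - Y" using X assms(2) by auto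
    have "partition_on A (insert X (P - {Y}))"
      using PY X \<open>X \<noteq> {}\<close> assms(2) eq dis
      by (subst partition_on_insert) (auto simp: disjnt_def)
    moreover have "card (insert X (P - {Y})) = r"
    proof -
      have "finite P" using finite_elements[OF _ P(1)] assms(1) by simp
      then show ?thesis using \<open>X \<notin> P\<close> P(2) Y(1) card_Suc_Diff1[of P Y] by simp
    qed
    moreover have "P = ?f (insert X (P - {Y}), X)"
      using X Y \<open>X \<notin> P\<close> by auto
    ultimately show "P \<in> ?f ` ?S"
      by (intro image_eqI[of _ _ "(insert X (P - {Y}), X)"]) (auto simp: partitions_into_def)
  qed
  show "?f ` ?S \<subseteq> ?L"
  proof clarify
    fix Q X assume "Q \<in> partitions_into A r" and X: "X \<in> Q"
    then have Q: "partition_on A Q" "card Q = r" by (auto simp: partitions_into_def)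
    have U: "\<Union>Q = A" using Q(1) by (simp add: partition_on_def)
    have dis: "Z \<inter> X = {}" if "Z \<in> Q" "Z \<noteq> X" for Z
      using Q(1) that X by (auto simp: partition_on_def disjoint_def)
    have "disjnt X (\<Union>(Q - {X}))" using dis by (auto simp: disjnt_def)
    from partition_on_insert[OF this, of A]
    have QX: "partition_on (A - X) (Q - {X})" "X \<subseteq> A" "X \<noteq> {}"
      using Q(1) X by (auto simp: insert_absorb)
    have xQ: "x \<notin> Z" if "Z \<in> Q" for Z using that U assms(2) by auto
    have "insert x A - insert x X = A - X" using assms(2) by auto
    then have "partition_on (insert x A) (insert (insert x X) (Q - {X}))"
      using QX dis xQ X by (subst partition_on_insert) (auto simp: disjnt_def)
    moreover have "card (insert (insert x X) (Q - {X})) = r"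
      using finite_elements[OF assms(1) Q(1)] xQ[of "insert x X"] X Q(2) card_Suc_Diff1[of Q X]
      by (subst card_insert_disjoint) auto
    moreover have "{x} \<notin> insert (insert x X) (Q - {X})"
      using xQ X QX(3) by blast
    ultimately show "insert (insert x X) (Q - {X}) \<in> partitions_into (insert x A) r \<and>
        {x} \<notin> insert (insert x X) (Q - {X})"
      by (auto simp: partitions_into_def)
  qed
qed

text \<open>Deleting \<open>x\<close> from all parts recovers \<open>Q\<close>, and deleting it from
  the only part that contains it recovers \<open>X\<close>.\<close>

lemma inj_on_extend_part:
  assumes "x \<notin> A"
  shows "inj_on (\<lambda>(Q, X). insert (insert x X) (Q - {X})) (SIGMA Q:partitions_into A r. Q)"
proof (rule inj_onI, clarify)
  fix Q X Q' X'
  assume Q: "Q \<in> partitions_into A r" "X \<in> Q" and Q': "Q' \<in> partitions_into A r" "X' \<in> Q'"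
    and eq: "insert (insert x X) (Q - {X}) = insert (insert x X') (Q' - {X'})"
  have x: "x \<notin> Z" if "Z \<in> Q \<or> Z \<in> Q'" for Z
    using that Q(1) Q'(1) assms by (auto simp: partitions_into_def partition_on_def)
  have recover: "(\<lambda>Y. Y - {x}) ` insert (insert x X) (Q - {X}) = Q"
    if "X \<in> Q" "\<And>Z. Z \<in> Q \<Longrightarrow> x \<notin> Z" for X Q
  proof -
    have "(\<lambda>Y. Y - {x}) ` (Q - {X}) = (\<lambda>Y. Y) ` (Q - {X})"
      using that(2) by (intro image_cong) auto
    then show ?thesis using that by (simp add: insert_absorb)
  qed
  have "Q = Q'"
    using recover[OF Q(2)] recover[OF Q'(2)] x eq by simp
  moreover have "insert x X = insert x X'"
    using eq x by blast
  then have "X = X'" using x Q(2) Q'(2) by (metis insert_ident)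
  ultimately show "Q = Q' \<and> X = X'" ..
qed

text \<open>Whether \<open>{x}\<close> is a part decides between the two summands of the recurrence;
  the factor \<open>Suc q\<close> counts the parts that \<open>x\<close> can join.\<close>

theorem card_partitions_into:
  "finite A \<Longrightarrow> card (partitions_into A r) = Stirling (card A) r"
proof (induction A arbitrary: r rule: finite_induct)
  case empty
  have "partitions_into ({} :: 'a set) r = (if r = 0 then {{}} else {})"
    by (auto simp: partitions_into_def partition_on_empty)
  then show ?case by (cases r) auto
next
  case (insert x A)
  note fin = finite_partitions_into[OF insert(1)]
  show ?case
  proof (cases r)
    case 0
    have "partitions_into (insert x A) 0 = {}"
    proof (rule equals0I)
      fix P assume "P \<in> partitions_into (insert x A) 0"
      then have "partition_on (insert x A) P" "card P = 0"
        by (auto simp: partitions_into_def)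
      with finite_elements[of "insert x A" P] insert(1) show False
        by (auto simp: partition_on_def)
    qed
    then show ?thesis using 0 insert by simp
  next
    case (Suc q)
    let ?P = "partitions_into (insert x A) (Suc q)"
    have "?P = {P \<in> ?P. {x} \<in> P} \<union> {P \<in> ?P. {x} \<notin> P}" by auto
    also have "card \<dots> = card {P \<in> ?P. {x} \<in> P} + card {P \<in> ?P. {x} \<notin> P}"
      using finite_partitions_into[of "insert x A"] insert(1) by (intro card_Un_disjoint) auto
    also have "card {P \<in> ?P. {x} \<in> P} = Stirling (card A) q"
    proof -
      have "\<And>Q. Q \<in> partitions_into A q \<Longrightarrow> {x} \<notin> Q"
        using insert(2) by (auto simp: partitions_into_def partition_on_def)
      then have "inj_on (insert {x}) (partitions_into A q)"
        by (intro inj_onI) (metis insert_ident)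
      then show ?thesis
        by (simp add: partitions_into_containing_singleton[OF insert(1,2)] card_image insert.IH)
    qed
    also have "card {P \<in> ?P. {x} \<notin> P} = Suc q * Stirling (card A) (Suc q)"
    proof -
      have "card {P \<in> ?P. {x} \<notin> P} = card (SIGMA Q:partitions_into A (Suc q). Q)"
        by (simp add: partitions_into_extending_part[OF insert(1,2)] card_image
            inj_on_extend_part[OF insert(2)])
      also have "\<dots> = (\<Sum>Q\<in>partitions_into A (Suc q). card Q)"
        using fin finite_elements[OF insert(1)]
        by (intro card_SigmaI) (auto simp: partitions_into_def)
      also have "\<dots> = (\<Sum>Q\<in>partitions_into A (Suc q). Suc q)"
        by (intro sum.cong) (auto simp: partitions_into_def)
      finally show ?thesis by (simp add: insert.IH)
    qed
    finally show ?thesis using Suc insert(1,2) by simp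
  qed
qed

section \<open>Sizes of stars in families of partitions\<close>

lemma partition_on_Un:
  assumes "partition_on A P" "partition_on B Q" "A \<inter> B = {}"
  shows "partition_on (A \<union> B) (P \<union> Q)"
proof (rule partition_onI)
  show "\<Union>(P \<union> Q) = A \<union> B" "{} \<notin> P \<union> Q"
    using assms by (auto simp: partition_on_def)
  have "disjnt p q" if "p \<in> P" "q \<in> Q" for p q
    using that assms unfolding partition_on_def disjnt_def by blast
  then show "disjnt p q" if "p \<in> P \<union> Q" "q \<in> P \<union> Q" "p \<noteq> q" for p q
    using that assms(1,2) by (auto simp: partition_on_def pairwise_def dest: disjnt_sym)
qed

lemma partition_on_Diff_subset:
  assumes "partition_on A P" "T \<subseteq> P"
  shows "partition_on (A - \<Union>T) (P - T)"
proof -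
  have "X \<inter> Y = {}" if "X \<in> P - T" "Y \<in> T" for X Y
    using assms that by (intro disjointD[OF partition_onD2[OF assms(1)]]) auto
  moreover have "\<Union>P = A" using assms(1) by (simp add: partition_on_def)
  ultimately have "\<Union>(P - T) = A - \<Union>T" by blast
  with assms show ?thesis
    by (auto simp: partition_on_def intro: pairwise_subset)
qed

text \<open>Once the parts in \<open>T\<close> are removed, what remains is an arbitrary partition
  of the uncovered points into the remaining number of parts.\<close>

lemma card_star_partitions_into:
  assumes "finite A" "partition_on (\<Union>T) T" "\<Union>T \<subseteq> A" "card T \<le> r"
  shows "card (star (partitions_into A r) T) = Stirling (card A - card (\<Union>T)) (r - card T)"
proof -
  have finU: "finite (\<Union>T)" using assms finite_subset by auto
  have finT: "finite T" using finite_elements[OF finU assms(2)] .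
  have "bij_betw (\<lambda>P. P - T) (star (partitions_into A r) T)
      (partitions_into (A - \<Union>T) (r - card T))"
  proof (rule bij_betw_byWitness[where f' = "\<lambda>Q. Q \<union> T"])
    \<comment> \<open>A common part would lie both inside and outside the union of \<open>T\<close>,
      hence be empty.\<close>
    have disj: "Q \<inter> T = {}" if "Q \<in> partitions_into (A - \<Union>T) (r - card T)" for Q
    proof -
      have "\<Union>Q = A - \<Union>T" "{} \<notin> Q" using that by (auto simp: partitions_into_def partition_on_def)
      moreover have "X = {}" if "X \<in> Q" "X \<in> T" for X
        using that \<open>\<Union>Q = A - \<Union>T\<close> by blast
      ultimately show ?thesis by blast
    qed
    show "\<forall>P\<in>star (partitions_into A r) T. P - T \<union> T = P"
      by (auto simp: star_def)
    show "\<forall>Q\<in>partitions_into (A - \<Union>T) (r - card T). Q \<union> T - T = Q"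
      using disj by blast
    show "(\<lambda>P. P - T) ` star (partitions_into A r) T \<subseteq> partitions_into (A - \<Union>T) (r - card T)"
      using finT by (auto simp: star_def partitions_into_def card_Diff_subset
          intro!: partition_on_Diff_subset)
    show "(\<lambda>Q. Q \<union> T) ` partitions_into (A - \<Union>T) (r - card T) \<subseteq> star (partitions_into A r) T"
    proof clarify
      fix Q assume Q: "Q \<in> partitions_into (A - \<Union>T) (r - card T)"
      then have part: "partition_on (A - \<Union>T) Q" "card Q = r - card T"
        by (auto simp: partitions_into_def)
      have "finite Q" using finite_elements[OF _ part(1)] assms(1) by simp
      then have "card (Q \<union> T) = r"
        using disj[OF Q] part(2) assms(4) finT by (simp add: card_Un_disjoint)
      moreover have "partition_on (A - \<Union>T \<union> \<Union>T) (Q \<union> T)"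
        using part(1) assms(2) by (rule partition_on_Un) auto
      moreover have "A - \<Union>T \<union> \<Union>T = A" using assms(3) by auto
      ultimately show "Q \<union> T \<in> star (partitions_into A r) T"
        by (simp add: star_def partitions_into_def)
    qed
  qed
  then show ?thesis
    using assms(1,3) finU by (simp add: bij_betw_same_card card_partitions_into card_Diff_subset)
qed

text \<open>At \<open>r = 0\<close> monotonicity fails: \<open>Stirling 0 0 = 1\<close>, but
  \<open>Stirling 1 0 = 0\<close>.\<close>

lemma Stirling_le_Suc: "1 \<le> r \<Longrightarrow> Stirling n r \<le> Stirling (Suc n) r"
  by (cases r) auto

lemma Stirling_mono: "1 \<le> r \<Longrightarrow> m \<le> n \<Longrightarrow> Stirling m r \<le> Stirling n r"
  by (rule lift_Suc_mono_le[where f = "\<lambda>n. Stirling n r"]) (rule Stirling_le_Suc)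

text \<open>If the star is non-empty, \<open>T\<close> consists of disjoint non-empty parts and
  covers at least \<open>card T\<close> points. So at most \<open>card A - card T\<close> points are
  left for the other parts, and monotonicity of the Stirling numbers applies.\<close>

lemma card_star_partitions_into_le:
  assumes "finite A" "finite T" "card T < r"
  shows "card (star (partitions_into A r) T) \<le> Stirling (card A - card T) (r - card T)"
proof (cases "star (partitions_into A r) T = {}")
  case False
  then obtain P where P: "partition_on A P" "T \<subseteq> P"
    by (auto simp: star_def partitions_into_def)
  have T: "partition_on (\<Union>T) T" "\<Union>T \<subseteq> A"
    using P by (auto simp: partition_on_def intro: pairwise_subset)
  have finX: "finite X" if "X \<in> T" for X
    using that T(2) by (intro finite_subset[OF _ assms(1)]) auto
  have "card T \<le> card (\<Union>T)"
  proof -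
    have "card T = (\<Sum>X\<in>T. 1)" by simp
    also have "\<dots> \<le> (\<Sum>X\<in>T. card X)"
    proof (rule sum_mono)
      fix X assume "X \<in> T"
      then have "X \<noteq> {}" "finite X"
        using T(1) finX by (auto simp: partition_on_def)
      then show "1 \<le> card X" by (simp add: Suc_le_eq card_gt_0_iff)
    qed
    also have "\<dots> = card (\<Union>T)"
      using T(1) finX by (intro product_partition[symmetric])
    finally show ?thesis .
  qed
  then show ?thesis
    using card_star_partitions_into[OF assms(1) T] assms(3) by (simp add: Stirling_mono)
qed auto

text \<open>Singletons cover as few points as possible, so they attain the bound of
  \<open>card_star_partitions_into_le\<close>.\<close>

lemma card_star_partitions_into_singletons:
  assumes "finite A" "B \<subseteq> A" "card B \<le> r"
  shows "card (star (partitions_into A r) ((\<lambda>x. {x}) ` B)) = Stirling (card A - card B) (r - card B)"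
proof -
  have "card ((\<lambda>x. {x}) ` B) = card B" by (simp add: card_image)
  then show ?thesis
    using card_star_partitions_into[OF assms(1), of "(\<lambda>x. {x}) ` B" r] assms(2,3)
      partition_on_singletons[of B] by simp
qed

section \<open>Growth of Stirling numbers\<close>

text \<open>Splitting a point off a part of size at least two turns a partition into \<open>p\<close> parts into one
  with \<open>p + 1\<close> parts; at most \<open>p (p + 1)\<close> ways lead to the same result.\<close>

lemma Stirling_split_le: "n * Stirling n p \<le> p * Stirling n p + p * Suc p * Stirling n (Suc p)"
proof (induction n arbitrary: p)
  case 0
  then show ?case by simp
next
  case (Suc n)
  show ?case
  proof (cases p)
    case 0
    then show ?thesis by simp
  next
    case p: (Suc q)
    let ?a = "Stirling n q" and ?b = "Stirling n p" and ?c = "Stirling n (Suc p)"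
    \<comment> \<open>After unfolding the recurrence, the hypothesis at \<open>q\<close> controls
      \<open>n * ?a\<close>, and the hypothesis at \<open>p\<close>, multiplied by \<open>p\<close>,
      controls \<open>n * (p * ?b)\<close>.\<close>
    have IH1: "n * ?a \<le> q * ?a + q * p * ?b"
      using Suc.IH[of q] p by simp
    have IH2: "p * (n * ?b) \<le> p * (p * ?b + p * Suc p * ?c)"
      using Suc.IH[of p] by (rule mult_le_mono2)
    have IH3: "n * ?b \<le> p * ?b + p * Suc p * ?c"
      using Suc.IH[of p] .
    have 1: "Stirling (Suc n) p = p * ?b + ?a" and 2: "Stirling (Suc n) (Suc p) = Suc p * ?c + ?b"
      using p by auto
    show ?thesis
      unfolding 1 2 using IH1 IH2 IH3 p by (simp add: algebra_simps)
  qed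
qed

text \<open>For \<open>n\<close> this large, the splitting inequality can be divided by
  \<open>p\<close>. Its right-hand side becomes the recurrence for
  \<open>Stirling (Suc n) (Suc p)\<close>, its left-hand side \<open>Suc c\<close> copies of
  \<open>Stirling n p\<close>; the spare positive copy gives strictness.\<close>

lemma mult_Stirling_less_Stirling_Suc:
  assumes "1 \<le> p" "p * Suc c \<le> n"
  shows "c * Stirling n p < Stirling (Suc n) (Suc p)"
proof -
  have pos: "0 < Stirling n p"
  proof -
    have "Stirling p p \<le> Stirling n p"
      using assms by (intro Stirling_mono) auto
    then show ?thesis by simp
  qed
  have "p * (Suc c * Stirling n p) \<le> n * Stirling n p"
    using mult_le_mono1[OF assms(2)] by (simp only: mult.assoc)
  also have "\<dots> \<le> p * (Stirling n p + Suc p * Stirling n (Suc p))"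
    using Stirling_split_le[of n p] by (simp only: distrib_left mult.assoc)
  finally have "Suc c * Stirling n p \<le> Stirling n p + Suc p * Stirling n (Suc p)"
    using assms(1) by (simp only: mult_le_cancel1)
  then show ?thesis using pos by simp
qed

section \<open>The star property of partitions\<close>

lemma c_const_ge:
  assumes "t \<le> r" "t \<le> s" "r \<le> r'" "s \<le> s'"
  shows "r * (s choose t) < c_const r' s' t" "s * (r choose t) < c_const r' s' t"
proof -
  have "r * (s choose t) \<le> r' * (s' choose t)" "s * (r choose t) \<le> s' * (r' choose t)"
    using assms by (auto intro!: mult_le_mono binomial_right_mono)
  then show "r * (s choose t) < c_const r' s' t" "s * (r choose t) < c_const r' s' t"
    using assms by (auto simp: c_const_def)
qed

theorem theorem4p12:
  fixes t k :: nat and r n :: "nat \<Rightarrow> nat"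
  assumes "2 \<le> k"
    and "2 \<le> t + 1"
    and "t + 1 < r 1"
    and "\<And>i j. 1 \<le> i \<Longrightarrow> i \<le> j \<Longrightarrow> j \<le> k \<Longrightarrow> r i \<le> r j"
    and "\<And>i. i \<in> {1..k} \<Longrightarrow> n i \<ge> (r i - t - 1) * c_const (r (k - 1)) (r k) t + t + 1"
  shows "extrastrong_cross_t_star_property t k (\<lambda>i. partitions_of_length (n i) (r i))"
proof -
  \<comment> \<open>With \<open>p = r i - t - 1\<close>, the assumption on \<open>n i\<close> reads
    \<open>p * Suc c \<le> n i - t - 1\<close>. The \<open>+ 1\<close> in \<open>c_const\<close>
    thus pays for the spare copy in \<open>mult_Stirling_less_Stirling_Suc\<close>, and
    \<open>c\<close> remains as the factor between the stars.\<close>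
  define c where "c = c_const (r (k - 1)) (r k) t - 1"
  have c: "c_const (r (k - 1)) (r k) t = Suc c"
    by (simp add: c_def c_const_def)
  have r: "t + 1 < r i" if "i \<in> {1..k}" for i
    using assms(3) assms(4)[of 1 i] that by auto
  have F: "partitions_of_length (n i) (r i) = partitions_into {1..n i} (r i)" for i
    by (simp add: partitions_of_length_def partitions_into_def)
  define m where "m i = Stirling (n i - Suc t) (r i - Suc t)" for i
  \<comment> \<open>These singletons are available in every family because
    \<open>t \<le> n i\<close>, so one set maximises the stars of \<open>t\<close>-sets in all
    families simultaneously.\<close>
  define T0 :: "nat set set" where "T0 = (\<lambda>x. {x}) ` {1..t}"
  have T0: "finite T0" "card T0 = t" by (auto simp: T0_def card_image)
  have n: "Suc t \<le> n i" if "i \<in> {1..k}" for i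
    using assms(5)[OF that] by simp
  have star0: "card (star (partitions_into {1..n i} (r i)) T0) = Stirling (n i - t) (r i - t)"
    if "i \<in> {1..k}" for i
    using card_star_partitions_into_singletons[of "{1..n i}" "{1..t}" "r i"] r[OF that] n[OF that]
    by (simp add: T0_def)
  have main: "c * m i < card (star (partitions_into {1..n i} (r i)) T0)" if i: "i \<in> {1..k}" for i
  proof -
    have "c * Stirling (n i - Suc t) (r i - Suc t) < Stirling (Suc (n i - Suc t)) (Suc (r i - Suc t))"
      using r[OF i] assms(5)[OF i] c by (intro mult_Stirling_less_Stirling_Suc) auto
    then show ?thesis
      using r[OF i] n[OF i] unfolding star0[OF i] m_def by (simp add: Suc_diff_Suc)
  qed
  \<comment> \<open>Of two distinct indices the smaller is at most \<open>k - 1\<close>. This is why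
    the two largest lengths \<open>r (k - 1)\<close> and \<open>r k\<close> suffice in the
    constant.\<close>
  have ratio_le: "r j * (r i choose t) \<le> c" if "i \<in> {1..k}" "j \<in> {1..k}" "i \<noteq> j" for i j
  proof (cases "i < j")
    case True
    then have "r i \<le> r (k - 1)" "r j \<le> r k" using that by (auto intro!: assms(4))
    from c_const_ge(2)[OF _ _ this, of t] show ?thesis
      using r[OF that(1)] r[OF that(2)] c by simp
  next
    case False
    then have "r j \<le> r (k - 1)" "r i \<le> r k" using that by (auto intro!: assms(4))
    from c_const_ge(1)[OF _ _ this, of t] show ?thesis
      using r[OF that(1)] r[OF that(2)] c by simp
  qed
  show ?thesis
    unfolding F
  proof (rule extrastrong_if_star_ratios[OF assms(1) _ _ T0, where m = m and r = r])
    fix i assume i: "i \<in> {1..k}"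
    show "finite (partitions_into {1..n i} (r i))"
      by (simp add: finite_partitions_into)
    show "finite P \<and> card P = r i" if "P \<in> partitions_into {1..n i} (r i)" for P
      using that finite_elements[of "{1..n i}" P] by (auto simp: partitions_into_def)
    show "card (star (partitions_into {1..n i} (r i)) T)
        \<le> card (star (partitions_into {1..n i} (r i)) T0)" if "finite T" "card T = t" for T
      using card_star_partitions_into_le[of "{1..n i}" T "r i"] that r[OF i]
      unfolding star0[OF i] by simp
    show "card (star (partitions_into {1..n i} (r i)) T) \<le> m i"
      if "finite T" "card T = Suc t" for T
      using card_star_partitions_into_le[of "{1..n i}" T "r i"] that r[OF i] by (simp add: m_def)
    show ratio: "r j * (r i choose t) * m i < card (star (partitions_into {1..n i} (r i)) T0)"
      if "j \<in> {1..k}" "i \<noteq> j" for j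
      using mult_le_mono1[OF ratio_le[OF i that]] main[OF i] by (rule le_less_trans)
    \<comment> \<open>With \<open>c\<close> positive, the gap \<open>c * m i\<close> between the
      stars is at least \<open>m i\<close>. The distinct indices \<open>1\<close> and
      \<open>k\<close> supply a positive lower bound for \<open>c\<close>.\<close>
    have "1 \<le> c"
    proof -
      have "0 < r k * (r 1 choose t)" using r[of 1] r[of k] assms(1) by auto
      also have "\<dots> \<le> c" using ratio_le[of 1 k] assms(1) by auto
      finally show ?thesis by simp
    qed
    then show "m i < card (star (partitions_into {1..n i} (r i)) T0)"
      using main[OF i] by (metis le_less_trans mult_le_mono1 mult_1)
  qed
qed

end
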